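(* Let $\mathcal{G}$ be a weakly logarithmic class of assemblies with parameters $\rho,\Theta,\theta,\theta'>0$ and $n_0\ge 1$. There is a constant $C>0$, depending only on $\rho,\Theta,\theta,\theta',n_0$, such that for every $n\ge1$ and every completely additive function $h:\mathcal{G}_n\to\mathbb{R}$, i.e. $h(\sigma)=\sum_{j=1}^n a_j k_j(\sigma)$ with arbitrary real $a_1,\dots,a_n$, $$\mathbf{V}_n h\le C\sum_{j=1}^n\lambda_j a_j^2\,\frac{Q(n-j)}{Q(n)}.$$
   Context: An assembly on a finite set is a partition of the set into blocks (components) together with a choice of one of finitely many structures on each block; for a block of size $j$ there are $g_j<\infty$ possible structures (the $g_j\ge 0$ are fixed integers characterizing the class $\mathcal{G}$). $\mathcal{G}_n$ is the set of assemblies on an $n$-element set. Put $\lambda_j=g_j/j!$. For $\bar s=(s_1,\dots,s_n)\in\mathbb{N}_0^n$ let $\ell(\bar s)=1s_1+2s_2+\cdots+ns_n$. Define $$Q(n)=\sum_{\ell(\bar s)=n}\prod_{i=1}^n\frac{\lambda_i^{s_i}}{s_i!},$$ with $Q(0)=1$. The number of assemblies in $\mathcal{G}_n$ is $G(n)=n!\,Q(n)$. The class $\mathcal{G}$ is weakly logarithmic if there are constants $\rho,\Theta,\theta,\theta'>0$ and $n_0\ge1$ such that: (i) $\rho^j j\lambda_j\le\Theta$ for all $j\ge1$; (ii) $\sum_{j\le n}\rho^j j\lambda_j\ge\theta n$ for all $n\ge n_0$; (iii) $nQ(n)\rho^n\ge\theta'\exp\{\sum_{j\le n}\lambda_j\rho^j\}$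 for all $n\ge1$. For $\sigma\in\mathcal{G}_n$ and $1\le j\le n$, $k_j(\sigma)\ge0$ denotes the number of components of size $j$ in $\sigma$. $\mathbf{E}_n$ and $\mathbf{V}_n$ denote expectation and variance with respect to the uniform probability measure on $\mathcal{G}_n$: $\mathbf{V}_n h=\frac{1}{G(n)}\sum_{\sigma\in\mathcal{G}_n}(h(\sigma)-\mathbf{E}_n h)^2$. *)

theory Defs
  imports "HOL-Analysis.Analysis" "HOL-Library.Disjoint_Sets"
begin

text \<open>An assembly on the n-element set {0..<n}: a set partition P of {0..<n} together
  with a choice of structure for each block B, encoded as a number f B < g (card B);
  outside the blocks f is normalised to 0 so that distinct assemblies are distinct pairs.\<close>

type_synonym assembly = "nat set set \<times> (nat set \<Rightarrow> nat)"

definition assemblies :: "(nat \<Rightarrow> nat) \<Rightarrow> nat \<Rightarrow> assembly set" where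
  "assemblies g n = {(P, f). partition_on {..<n} P \<and>
      (\<forall>B\<in>P. f B < g (card B)) \<and> (\<forall>B. B \<notin> P \<longrightarrow> f B = 0)}"

definition kcomp :: "nat \<Rightarrow> assembly \<Rightarrow> nat" where
  "kcomp j \<sigma> = card {B \<in> fst \<sigma>. card B = j}"

definition lam :: "(nat \<Rightarrow> nat) \<Rightarrow> nat \<Rightarrow> real" where
  "lam g j = real (g j) / fact j"

definition svecs :: "nat \<Rightarrow> (nat \<Rightarrow> nat) set" where
  "svecs n = {s. (\<forall>i. i \<notin> {1..n} \<longrightarrow> s i = 0) \<and> (\<Sum>i=1..n. i * s i) = n}"

definition Qfun :: "(nat \<Rightarrow> nat) \<Rightarrow> nat \<Rightarrow> real" where
  "Qfun g n = (\<Sum>s\<in>svecs n. \<Prod>i=1..n. lam g i ^ s i / fact (s i))"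

definition En :: "(nat \<Rightarrow> nat) \<Rightarrow> nat \<Rightarrow> (assembly \<Rightarrow> real) \<Rightarrow> real" where
  "En g n h = (\<Sum>\<sigma>\<in>assemblies g n. h \<sigma>) / real (card (assemblies g n))"

definition Vn :: "(nat \<Rightarrow> nat) \<Rightarrow> nat \<Rightarrow> (assembly \<Rightarrow> real) \<Rightarrow> real" where
  "Vn g n h = (\<Sum>\<sigma>\<in>assemblies g n. (h \<sigma> - En g n h)^2) / real (card (assemblies g n))"

definition weakly_logarithmic ::
  "(nat \<Rightarrow> nat) \<Rightarrow> real \<Rightarrow> real \<Rightarrow> real \<Rightarrow> real \<Rightarrow> nat \<Rightarrow> bool" where
  "weakly_logarithmic g \<rho> \<Theta> \<theta> \<theta>' n0 \<longleftrightarrow>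
     \<rho> > 0 \<and> \<Theta> > 0 \<and> \<theta> > 0 \<and> \<theta>' > 0 \<and> n0 \<ge> 1 \<and>
     (\<forall>j\<ge>1. \<rho>^j * real j * lam g j \<le> \<Theta>) \<and>
     (\<forall>n\<ge>n0. (\<Sum>j=1..n. \<rho>^j * real j * lam g j) \<ge> \<theta> * real n) \<and>
     (\<forall>n\<ge>1. real n * Qfun g n * \<rho>^n \<ge> \<theta>' * exp (\<Sum>j=1..n. lam g j * \<rho>^j))"

end

theory Submission
  imports Defs
begin

text \<open>Under the uniform measure the component counts are independent Poisson variables with
  parameters \<open>m j = lam g j * \<rho> ^ j\<close>, conditioned on the event that the total size \<open>T\<close> is \<open>n\<close>.
  Split \<open>h\<close> at component size \<open>n / 2\<close>. There is at most one component larger than \<open>n / 2\<close>, so the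
  square of that part of \<open>h\<close> is again additive. Let \<open>X\<close> be the rest, centred at its Poisson mean.
  Marking an element gives
  \<open>n E[X\<^sup>2; T = n] = (\<Sum>j. j (m j) E[(X + a j)\<^sup>2; T = n - j])\<close>, and since \<open>j (m j) \<le> \<Theta>\<close> the
  right-hand side is at most \<open>2 \<Theta>\<close> times the unconditional variance of \<open>X\<close>, plus a harmless
  diagonal term. Dividing by \<open>n P(T = n) \<ge> \<theta>'\<close> gives the bound.\<close>

section \<open>Weighted sums over component vectors\<close>

text \<open>For nonnegative \<open>l\<close> this is the unnormalised conditional expectation: with
  independent Poisson counts \<open>s i\<close> of parameters \<open>l i\<close>, it equals
  \<open>exp (\<Sum>i=1..n. l i)\<close> times E[F(s); T = n]. Dropping the exponential keeps every
  identity below a finite sum.\<close>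

definition gsum :: "(nat \<Rightarrow> real) \<Rightarrow> nat \<Rightarrow> ((nat \<Rightarrow> nat) \<Rightarrow> real) \<Rightarrow> real" where
  "gsum l n F = (\<Sum>s\<in>svecs n. (\<Prod>i=1..n. l i ^ s i / fact (s i)) * F s)"

lemma svecs_le:
  assumes "s \<in> svecs n"
  shows "s i \<le> n"
proof (cases "i \<in> {1..n}")
  case True
  then have "i * s i \<le> (\<Sum>i=1..n. i * s i)"
    by (intro member_le_sum) auto
  then have "i * s i \<le> n" using assms by (simp add: svecs_def)
  moreover have "s i \<le> i * s i" using True by simp
  ultimately show ?thesis by linarith
qed (use assms in \<open>auto simp: svecs_def\<close>)

lemma finite_svecs: "finite (svecs n)"
proof (rule finite_subset)
  show "svecs n \<subseteq> {f. \<forall>i. (i \<in> {1..n} \<longrightarrow> f i \<in> {..n}) \<and> (i \<notin> {1..n} \<longrightarrow> f i = 0)}"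
  proof
    fix s assume s: "s \<in> svecs n"
    then have "s i = 0" if "i \<notin> {1..n}" for i using that by (simp add: svecs_def)
    with svecs_le[OF s]
    show "s \<in> {f. \<forall>i. (i \<in> {1..n} \<longrightarrow> f i \<in> {..n}) \<and> (i \<notin> {1..n} \<longrightarrow> f i = 0)}" by blast
  qed
qed (intro finite_set_of_finite_funs; simp)

lemma svecs_zero: "svecs 0 = {\<lambda>_. 0}"
  by (auto simp: svecs_def)

lemma svecs_sum_extend:
  assumes "s \<in> svecs m" "m \<le> n"
  shows "(\<Sum>i=1..n. i * s i) = m"
proof -
  have "(\<Sum>i=1..n. i * s i) = (\<Sum>i=1..m. i * s i)"
    using assms by (intro sum.mono_neutral_right) (auto simp: svecs_def)
  then show ?thesis using assms by (simp add: svecs_def)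
qed

lemma svecs_prod_extend:
  fixes l :: "nat \<Rightarrow> real"
  assumes "s \<in> svecs m" "m \<le> n"
  shows "(\<Prod>i=1..n. l i ^ s i / fact (s i)) = (\<Prod>i=1..m. l i ^ s i / fact (s i))"
  using assms by (intro prod.mono_neutral_right) (auto simp: svecs_def)

text \<open>A part larger than \<open>m\<close> would already exceed the total \<open>m\<close>.
  Vectors with different totals can therefore be compared over one common index range.\<close>

lemma svecs_iff:
  assumes "m \<le> n"
  shows "s \<in> svecs m \<longleftrightarrow> (\<forall>i. i \<notin> {1..n} \<longrightarrow> s i = 0) \<and> (\<Sum>i=1..n. i * s i) = m"
proof
  assume "s \<in> svecs m"
  then show "(\<forall>i. i \<notin> {1..n} \<longrightarrow> s i = 0) \<and> (\<Sum>i=1..n. i * s i) = m"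
    using svecs_sum_extend[OF _ assms] assms by (auto simp: svecs_def)
next
  assume s: "(\<forall>i. i \<notin> {1..n} \<longrightarrow> s i = 0) \<and> (\<Sum>i=1..n. i * s i) = m"
  have z: "s i = 0" if "i \<notin> {1..m}" for i
  proof (rule ccontr)
    assume "s i \<noteq> 0"
    then have i: "i \<in> {1..n}" using s by auto
    then have "i * s i \<le> (\<Sum>i=1..n. i * s i)" by (intro member_le_sum) auto
    moreover have "i \<le> i * s i" using \<open>s i \<noteq> 0\<close> by simp
    moreover have "m < i" using that i by simp
    ultimately show False using s by linarith
  qed
  have "(\<Sum>i=1..n. i * s i) = (\<Sum>i=1..m. i * s i)"
    using z assms by (intro sum.mono_neutral_right) auto
  then show "s \<in> svecs m" using s z by (simp add: svecs_def)
qed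

lemma svecs_add_part_iff:
  assumes "j \<in> {1..n}"
  shows "s(j := Suc (s j)) \<in> svecs n \<longleftrightarrow> s \<in> svecs (n - j)"
proof -
  have "(\<Sum>i=1..n. i * (s(j := Suc (s j))) i) = j + (\<Sum>i=1..n. i * s i)"
  proof -
    have "(\<Sum>i=1..n. i * (s(j := Suc (s j))) i) = (\<Sum>i=1..n. (if i = j then j else 0) + i * s i)"
      by (intro sum.cong) auto
    also have "\<dots> = j + (\<Sum>i=1..n. i * s i)"
      using assms by (simp add: sum.distrib)
    finally show ?thesis .
  qed
  then show ?thesis
    using assms svecs_iff[of "n - j" n s] svecs_iff[of n n "s(j := Suc (s j))"] by auto
qed

text \<open>Deleting the marked part of size \<open>j\<close> is a bijection onto vectors of total
  \<open>n - j\<close>, and \<open>k * x ^ k / fact k = x * x ^ (k - 1) / fact (k - 1)\<close> for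
  \<open>k > 0\<close> accounts for the weights. This is the size-biasing identity for Poisson
  variables.\<close>

lemma gsum_mark:
  assumes j: "j \<in> {1..n}"
  shows "gsum l n (\<lambda>s. real (s j) * F s) = l j * gsum l (n - j) (\<lambda>s. F (s(j := Suc (s j))))"
proof -
  define w where "w s = (\<Prod>i=1..n. l i ^ s i / fact (s i))" for s :: "nat \<Rightarrow> nat"
  have step: "w (s(j := Suc (s j))) * real (Suc (s j)) = l j * w s" for s
  proof -
    define R where "R = (\<Prod>i\<in>{1..n}-{j}. l i ^ s i / fact (s i))"
    have w1: "w (s(j := Suc (s j))) = (l j ^ Suc (s j) / fact (Suc (s j))) * R"
      unfolding w_def R_def using j by (subst prod.remove[of _ j]) (auto intro!: prod.cong)
    have w0: "w s = (l j ^ s j / fact (s j)) * R"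
      unfolding w_def R_def using j by (subst prod.remove[of _ j]) auto
    show ?thesis unfolding w1 w0 by (simp add: field_simps del: of_nat_Suc)
  qed
  \<comment> \<open>Vectors without a part of size \<open>j\<close> contribute nothing; discarding
    them makes the truncated subtraction \<open>s j - 1\<close> invertible.\<close>
  have "gsum l n (\<lambda>s. real (s j) * F s) = (\<Sum>s\<in>{s\<in>svecs n. s j \<noteq> 0}. w s * (real (s j) * F s))"
    unfolding gsum_def w_def
    by (intro sum.mono_neutral_right) (auto simp: finite_svecs)
  also have "\<dots> = (\<Sum>s\<in>svecs (n - j). l j * (w s * F (s(j := Suc (s j)))))"
  proof (rule sum.reindex_bij_witness[where i = "\<lambda>s. s(j := Suc (s j))" and j = "\<lambda>s. s(j := s j - 1)"])
    fix s assume s: "s \<in> {s \<in> svecs n. s j \<noteq> 0}"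
    then show eq: "(s(j := s j - 1))(j := Suc ((s(j := s j - 1)) j)) = s" by auto
    show "s(j := s j - 1) \<in> svecs (n - j)"
      using svecs_add_part_iff[OF j, of "s(j := s j - 1)"] s eq by simp
    have "w s * real (s j) = l j * w (s(j := s j - 1))"
      using step[of "s(j := s j - 1)"] s by simp
    then show "l j * (w (s(j := s j - 1)) * F ((s(j := s j - 1))(j := Suc ((s(j := s j - 1)) j))))
        = w s * (real (s j) * F s)"
      unfolding eq by (metis mult.assoc)
  qed (use svecs_add_part_iff[OF j] in auto)
  also have "\<dots> = l j * gsum l (n - j) (\<lambda>s. F (s(j := Suc (s j))))"
    unfolding gsum_def sum_distrib_left w_def
    by (intro sum.cong refl) (use svecs_prod_extend[of _ "n - j" n l] in simp)
  finally show ?thesis .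
qed

lemma gsum_add: "gsum l n (\<lambda>s. F s + G s) = gsum l n F + gsum l n G"
  by (simp add: gsum_def sum.distrib algebra_simps)

lemma gsum_cmult: "gsum l n (\<lambda>s. c * F s) = c * gsum l n F"
  by (simp add: gsum_def sum_distrib_left algebra_simps)

lemma gsum_sum: "gsum l n (\<lambda>s. \<Sum>j\<in>J. F j s) = (\<Sum>j\<in>J. gsum l n (F j))"
  unfolding gsum_def sum_distrib_left by (rule sum.swap)

lemma gsum_cong: "(\<And>s. s \<in> svecs n \<Longrightarrow> F s = G s) \<Longrightarrow> gsum l n F = gsum l n G"
  unfolding gsum_def by (intro sum.cong) auto

lemma gsum_mono:
  assumes "\<And>i. l i \<ge> 0" "\<And>s. s \<in> svecs n \<Longrightarrow> F s \<le> G s"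
  shows "gsum l n F \<le> gsum l n G"
  unfolding gsum_def using assms by (intro sum_mono mult_left_mono prod_nonneg) auto

lemma gsum_nonneg:
  assumes "\<And>i. l i \<ge> 0" "\<And>s. F s \<ge> 0"
  shows "gsum l n F \<ge> 0"
  unfolding gsum_def using assms by (intro sum_nonneg mult_nonneg_nonneg prod_nonneg) auto

text \<open>On \<open>svecs n\<close> the factor \<open>n\<close> can be replaced by the sum of
  \<open>j * s j\<close>, and each summand is then marked.\<close>

lemma gsum_rec:
  "real n * gsum l n F =
    (\<Sum>j=1..n. real j * l j * gsum l (n - j) (\<lambda>s. F (s(j := Suc (s j)))))"
proof -
  have "real n * gsum l n F = gsum l n (\<lambda>s. \<Sum>j=1..n. real j * (real (s j) * F s))"
    unfolding gsum_cmult[symmetric]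
  proof (rule gsum_cong)
    fix s assume "s \<in> svecs n"
    then have "real n = real (\<Sum>j=1..n. j * s j)" by (simp add: svecs_def)
    also have "\<dots> = (\<Sum>j=1..n. real j * real (s j))" by simp
    finally have "real n = (\<Sum>j=1..n. real j * real (s j))" .
    then show "real n * F s = (\<Sum>j=1..n. real j * (real (s j) * F s))"
      by (metis (no_types, lifting) mult.assoc sum.cong sum_distrib_right)
  qed
  also have "\<dots> = (\<Sum>j=1..n. real j * gsum l n (\<lambda>s. real (s j) * F s))"
    by (simp add: gsum_sum gsum_cmult)
  also have "\<dots> = (\<Sum>j=1..n. real j * l j * gsum l (n - j) (\<lambda>s. F (s(j := Suc (s j)))))"
    by (intro sum.cong refl) (subst gsum_mark, auto)
  finally show ?thesis .
qed

lemma gsum_zero: "gsum l 0 F = F (\<lambda>_. 0)"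
  by (simp add: gsum_def svecs_zero)

lemma Qfun_eq_gsum: "Qfun g n = gsum (lam g) n (\<lambda>_. 1)"
  by (simp add: Qfun_def gsum_def)

text \<open>The powers of \<open>r\<close> collect to exactly \<open>r ^ n\<close> because the total
  size is fixed. Tilting thus leaves the conditional law unchanged, which frees the choice of
  Poisson parameters.\<close>

lemma gsum_tilt: "gsum (\<lambda>j. l j * r ^ j) n F = r ^ n * gsum l n F"
  unfolding gsum_def sum_distrib_left
proof (intro sum.cong refl)
  fix s assume "s \<in> svecs n"
  then have "r ^ n = (\<Prod>i=1..n. r ^ (i * s i))" by (simp add: svecs_def flip: power_sum)
  then show "(\<Prod>i=1..n. (l i * r ^ i) ^ s i / fact (s i)) * F s =
      r ^ n * ((\<Prod>i=1..n. l i ^ s i / fact (s i)) * F s)"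
    by (simp add: power_mult_distrib power_mult prod_dividef prod.distrib)
qed

section \<open>From assemblies to component vectors\<close>

text \<open>The ground set is arbitrary because removing a block from an initial segment need not
  leave an initial segment.\<close>

definition assemblies_on :: "(nat \<Rightarrow> nat) \<Rightarrow> nat set \<Rightarrow> assembly set" where
  "assemblies_on g A = {(P, f). partition_on A P \<and>
      (\<forall>B\<in>P. f B < g (card B)) \<and> (\<forall>B. B \<notin> P \<longrightarrow> f B = 0)}"

lemma finite_assemblies_on:
  assumes "finite A"
  shows "finite (assemblies_on g A)"
proof (rule finite_subset)
  define M where "M = (\<Sum>B\<in>Pow A. g (card B))"
  let ?F = "{f :: nat set \<Rightarrow> nat. \<forall>B. (B \<in> Pow A \<longrightarrow> f B \<in> {..M}) \<and> (B \<notin> Pow A \<longrightarrow> f B = 0)}"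
  show "finite (Pow (Pow A) \<times> ?F)"
    using assms by (intro finite_cartesian_product finite_set_of_finite_funs) auto
  have M: "g (card B) \<le> M" if "B \<in> Pow A" for B
    unfolding M_def using assms that by (intro member_le_sum) auto
  show "assemblies_on g A \<subseteq> Pow (Pow A) \<times> ?F"
  proof
    fix \<sigma> assume "\<sigma> \<in> assemblies_on g A"
    then obtain P f where \<sigma>: "\<sigma> = (P, f)" and P: "partition_on A P"
      and f: "\<And>B. B \<in> P \<Longrightarrow> f B < g (card B)" "\<And>B. B \<notin> P \<Longrightarrow> f B = 0"
      by (auto simp: assemblies_on_def)
    have PA: "P \<subseteq> Pow A" using P by (auto simp: partition_on_def)
    have "f B \<le> M" if "B \<in> Pow A" for B
      using f[of B] M[OF that] by (cases "B \<in> P") auto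
    moreover have "f B = 0" if "B \<notin> Pow A" for B using f(2) PA that by blast
    ultimately show "\<sigma> \<in> Pow (Pow A) \<times> ?F" using PA by (auto simp: \<sigma>)
  qed
qed

lemma partition_on_insert_block:
  assumes "partition_on (A - B) P" "B \<subseteq> A" "B \<noteq> {}"
  shows "partition_on A (insert B P)" "B \<notin> P"
proof -
  have U: "\<Union>P = A - B" using assms by (simp add: partition_on_def)
  show nB: "B \<notin> P" using U assms by auto
  show "partition_on A (insert B P)"
    using assms U unfolding partition_on_def disjoint_def by auto
qed

lemma partition_on_remove_block:
  assumes "partition_on A P" "B \<in> P"
  shows "partition_on (A - B) (P - {B})"
  using assms unfolding partition_on_def disjoint_def by auto

text \<open>Exactly one block \<open>B\<close> contains \<open>x\<close>; an assembly is determined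
  by \<open>B\<close>, its structure \<open>c\<close>, and the assembly induced on the remaining
  elements.\<close>

lemma sum_assemblies_on_rec:
  fixes H :: "assembly \<Rightarrow> real"
  assumes A: "finite A" and x: "x \<in> A"
  shows "(\<Sum>\<sigma>\<in>assemblies_on g A. H \<sigma>) =
    (\<Sum>B\<in>{B. x \<in> B \<and> B \<subseteq> A}. \<Sum>c<g (card B). \<Sum>\<sigma>\<in>assemblies_on g (A - B).
       H (insert B (fst \<sigma>), (snd \<sigma>)(B := c)))"
proof -
  let ?S = "{B. x \<in> B \<and> B \<subseteq> A}"
  let ?T = "SIGMA B:?S. {..<g (card B)} \<times> assemblies_on g (A - B)"
  define i where "i = (\<lambda>(B, c, \<sigma>). (insert B (fst \<sigma>), (snd \<sigma>)(B := c)) :: assembly)"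
  define b where "b P = (THE B. B \<in> P \<and> x \<in> B)" for P :: "nat set set"
  \<comment> \<open>The structure function is reset to 0 at the deleted block, as the normalisation
    outside the partition demands.\<close>
  define j where "j = (\<lambda>(P, f). (b P, f (b P), (P - {b P}, f(b P := 0))) :: nat set \<times> nat \<times> assembly)"
  have fS: "finite ?S" using A by (auto intro: finite_subset[of _ "Pow A"])
  have b: "b P = B" if "partition_on A P" "B \<in> P" "x \<in> B" for P B
    unfolding b_def using that by (intro the_equality) (auto simp: partition_on_def disjoint_def)
  have bex: "\<exists>B\<in>P. x \<in> B" if "partition_on A P" for P
    using that x unfolding partition_on_def by blast
  have "(\<Sum>\<sigma>\<in>assemblies_on g A. H \<sigma>) = (\<Sum>t\<in>?T. H (i t))"
  proof (rule sum.reindex_bij_witness[where i = i and j = j])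
    fix \<sigma> assume "\<sigma> \<in> assemblies_on g A"
    then obtain P f where \<sigma>: "\<sigma> = (P, f)" and P: "partition_on A P"
      and f: "\<And>B. B \<in> P \<Longrightarrow> f B < g (card B)" "\<And>B. B \<notin> P \<Longrightarrow> f B = 0"
      by (auto simp: assemblies_on_def)
    obtain B where B: "B \<in> P" "x \<in> B" using bex[OF P] by auto
    have bB: "b P = B" using b P B by auto
    show "i (j \<sigma>) = \<sigma>" using B by (auto simp: \<sigma> i_def j_def bB)
    then show "H (i (j \<sigma>)) = H \<sigma>" by simp
    have "B \<subseteq> A" using P B by (auto simp: partition_on_def)
    then show "j \<sigma> \<in> ?T"
      using B f partition_on_remove_block[OF P B(1)] by (auto simp: \<sigma> j_def bB assemblies_on_def)
  next
    fix t assume "t \<in> ?T"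
    then obtain B c P f where t: "t = (B, c, P, f)" and B: "x \<in> B" "B \<subseteq> A" and c: "c < g (card B)"
      and P: "partition_on (A - B) P" and f: "\<And>B. B \<in> P \<Longrightarrow> f B < g (card B)" "\<And>B. B \<notin> P \<Longrightarrow> f B = 0"
      by (auto simp: assemblies_on_def)
    have ins: "partition_on A (insert B P)" "B \<notin> P"
      using partition_on_insert_block[OF P] B by auto
    have bB: "b (insert B P) = B" using b[OF ins(1)] B by auto
    show "j (i t) = t" using ins f by (auto simp: t i_def j_def bB fun_eq_iff)
    show "i t \<in> assemblies_on g A" using ins f c by (auto simp: t i_def assemblies_on_def)
  qed
  also have "\<dots> = (\<Sum>B\<in>?S. \<Sum>(c, \<sigma>)\<in>{..<g (card B)} \<times> assemblies_on g (A - B).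
       H (insert B (fst \<sigma>), (snd \<sigma>)(B := c)))"
    using fS finite_assemblies_on A by (subst sum.Sigma) (auto simp: i_def split_def)
  finally show ?thesis by (simp add: sum.cartesian_product)
qed

text \<open>The structure functions \<open>f\<close> and \<open>f'\<close> are unrelated because
  component counts see only the partition.\<close>

lemma kcomp_insert_block:
  assumes "finite P" "B \<notin> P"
  shows "(\<lambda>j. kcomp j (insert B P, f)) = (\<lambda>j. kcomp j (P, f'))(card B := Suc (kcomp (card B) (P, f')))"
proof
  fix j
  have "{C \<in> insert B P. card C = j} = (if card B = j then insert B {C \<in> P. card C = j} else {C \<in> P. card C = j})"
    by auto
  then show "kcomp j (insert B P, f) = ((\<lambda>j. kcomp j (P, f'))(card B := Suc (kcomp (card B) (P, f')))) j"
    using assms by (auto simp: kcomp_def)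
qed

lemma card_subsets_containing:
  assumes "finite A" "x \<in> A" "j \<ge> 1"
  shows "card {B. x \<in> B \<and> B \<subseteq> A \<and> card B = j} = (card A - 1) choose (j - 1)"
proof -
  have "bij_betw (insert x) {B. B \<subseteq> A - {x} \<and> card B = j - 1} {B. x \<in> B \<and> B \<subseteq> A \<and> card B = j}"
  proof (rule bij_betw_byWitness[where f' = "\<lambda>B. B - {x}"])
    show "insert x ` {B. B \<subseteq> A - {x} \<and> card B = j - 1} \<subseteq> {B. x \<in> B \<and> B \<subseteq> A \<and> card B = j}"
      using assms by (auto simp: card_insert_if finite_subset)
    show "(\<lambda>B. B - {x}) ` {B. x \<in> B \<and> B \<subseteq> A \<and> card B = j} \<subseteq> {B. B \<subseteq> A - {x} \<and> card B = j - 1}"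
      using assms by auto
  qed auto
  then have "card {B. x \<in> B \<and> B \<subseteq> A \<and> card B = j} = card {B. B \<subseteq> A - {x} \<and> card B = j - 1}"
    by (simp add: bij_betw_same_card)
  also have "\<dots> = (card A - 1) choose (j - 1)"
    using assms n_subsets[of "A - {x}" "j - 1"] by simp
  finally show ?thesis .
qed

text \<open>Both sides satisfy the same recursion: on the left the block of a fixed element is
  removed, on the right \<open>gsum_rec\<close> removes a part. \<open>F\<close> is generalised in
  the induction because the removed block shifts its argument.\<close>

lemma sum_assemblies_on_eq_gsum:
  assumes "finite A"
  shows "(\<Sum>\<sigma>\<in>assemblies_on g A. F (\<lambda>j. kcomp j \<sigma>)) = fact (card A) * gsum (lam g) (card A) F"
  using assms
proof (induction "card A" arbitrary: A F rule: less_induct)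
  case less
  show ?case
  proof (cases "A = {}")
    case True
    have "assemblies_on g {} = {({}, \<lambda>_. 0)}" by (auto simp: assemblies_on_def partition_on_empty)
    then show ?thesis using True by (simp add: kcomp_def gsum_zero)
  next
    case False
    then obtain x where x: "x \<in> A" by auto
    define n where "n = card A"
    have n: "n \<ge> 1" using x less.prems by (simp add: n_def Suc_le_eq card_gt_0_iff) auto
    let ?S = "{B. x \<in> B \<and> B \<subseteq> A}"
    define T where "T j = real (g j) * (fact (n - j) * gsum (lam g) (n - j) (\<lambda>s. F (s(j := Suc (s j)))))" for j
    have fS: "finite ?S" using less.prems by (auto intro: finite_subset[of _ "Pow A"])
    have "(\<Sum>\<sigma>\<in>assemblies_on g A. F (\<lambda>j. kcomp j \<sigma>)) = (\<Sum>B\<in>?S. T (card B))"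
      unfolding sum_assemblies_on_rec[OF less.prems x]
    proof (intro sum.cong refl)
      fix B assume B: "B \<in> ?S"
      then have fB: "finite B" using less.prems finite_subset by auto
      have cB: "card B \<ge> 1" using B fB by (auto simp: Suc_le_eq card_gt_0_iff)
      have c: "card (A - B) = n - card B" using B fB by (simp add: card_Diff_subset n_def)
      have "(\<Sum>c<g (card B). \<Sum>\<sigma>\<in>assemblies_on g (A - B). F (\<lambda>j. kcomp j (insert B (fst \<sigma>), (snd \<sigma>)(B := c))))
         = (\<Sum>c<g (card B). \<Sum>\<sigma>\<in>assemblies_on g (A - B). F ((\<lambda>j. kcomp j \<sigma>)(card B := Suc (kcomp (card B) \<sigma>))))"
      proof (intro sum.cong refl)
        fix \<sigma> c assume "\<sigma> \<in> assemblies_on g (A - B)"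
        then obtain P f where \<sigma>: "\<sigma> = (P, f)" and P: "partition_on (A - B) P" by (auto simp: assemblies_on_def)
        have "finite P" using finite_elements[OF _ P] less.prems by auto
        moreover have "B \<notin> P" using partition_on_insert_block[OF P] B by auto
        ultimately show "F (\<lambda>j. kcomp j (insert B (fst \<sigma>), (snd \<sigma>)(B := c))) =
            F ((\<lambda>j. kcomp j \<sigma>)(card B := Suc (kcomp (card B) \<sigma>)))"
          using kcomp_insert_block[of P B _ f] \<sigma> by simp
      qed
      also have "\<dots> = real (g (card B)) *
          (\<Sum>\<sigma>\<in>assemblies_on g (A - B). F ((\<lambda>j. kcomp j \<sigma>)(card B := Suc (kcomp (card B) \<sigma>))))"
        by simp
      also have "\<dots> = T (card B)"
        using less.hyps[of "A - B" "\<lambda>s. F (s(card B := Suc (s (card B))))"] less.prems cB n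
        by (simp add: c T_def n_def[symmetric])
      finally show "(\<Sum>c<g (card B). \<Sum>\<sigma>\<in>assemblies_on g (A - B).
          F (\<lambda>j. kcomp j (insert B (fst \<sigma>), (snd \<sigma>)(B := c)))) = T (card B)" .
    qed
    \<comment> \<open>The summand depends on \<open>B\<close> only through its size, so blocks of
      equal size are collected and counted by a binomial coefficient.\<close>
    also have "\<dots> = (\<Sum>j=1..n. \<Sum>B\<in>{B\<in>?S. card B = j}. T (card B))"
    proof (rule sum.group[symmetric, OF fS])
      show "card ` ?S \<subseteq> {1..n}"
      proof safe
        fix B assume B: "x \<in> B" "B \<subseteq> A"
        then have "finite B" using less.prems finite_subset by auto
        then show "card B \<in> {1..n}"
          using B less.prems by (auto simp: n_def Suc_le_eq card_gt_0_iff card_mono)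
      qed
    qed simp
    also have "\<dots> = (\<Sum>j=1..n. real ((n - 1) choose (j - 1)) * T j)"
      using card_subsets_containing[OF less.prems x] by (intro sum.cong refl) (simp add: n_def conj_assoc)
    \<comment> \<open>The coefficients match because
      \<open>((n - 1) choose (j - 1)) * g j * fact (n - j)\<close> equals
      \<open>fact (n - 1) * j * lam g j\<close>.\<close>
    also have "\<dots> = fact (n - 1) * (\<Sum>j=1..n. real j * lam g j * gsum (lam g) (n - j) (\<lambda>s. F (s(j := Suc (s j)))))"
      unfolding sum_distrib_left
    proof (intro sum.cong refl)
      fix j assume j: "j \<in> {1..n}"
      then have "real ((n - 1) choose (j - 1)) = fact (n - 1) / (fact (j - 1) * fact (n - j))"
        by (subst binomial_fact) auto
      moreover have "fact j = real j * (fact (j - 1) :: real)" using j by (simp add: fact_reduce)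
      ultimately show "real ((n - 1) choose (j - 1)) * T j =
         fact (n - 1) * (real j * lam g j * gsum (lam g) (n - j) (\<lambda>s. F (s(j := Suc (s j)))))"
        using j by (simp add: T_def lam_def field_simps)
    qed
    also have "\<dots> = fact n * gsum (lam g) n F"
      using n by (subst gsum_rec[symmetric]) (simp add: fact_reduce[of n])
    finally show ?thesis by (simp add: n_def)
  qed
qed

lemma assemblies_eq_assemblies_on: "assemblies g n = assemblies_on g {..<n}"
  by (simp add: assemblies_def assemblies_on_def)

lemma sum_assemblies_eq_gsum:
  "(\<Sum>\<sigma>\<in>assemblies g n. F (\<lambda>j. kcomp j \<sigma>)) = fact n * gsum (lam g) n F"
  using sum_assemblies_on_eq_gsum[of "{..<n}" F g] by (simp add: assemblies_eq_assemblies_on)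

lemma card_assemblies: "real (card (assemblies g n)) = fact n * Qfun g n"
  using sum_assemblies_eq_gsum[where F = "\<lambda>_. 1"] by (simp add: Qfun_eq_gsum)

section \<open>The unconditional Poisson variance\<close>

text \<open>Total mass, centred first moment and variance, all without the factor
  \<open>exp (- x)\<close>. Raw moments come from the index shift that cancels one factor of the
  factorial.\<close>

lemma poisson_moments:
  fixes x :: real
  shows "(\<lambda>k. x ^ k / fact k) sums exp x"
    and "(\<lambda>k. x ^ k / fact k * (real k - x)) sums 0"
    and "(\<lambda>k. x ^ k / fact k * (real k - x)\<^sup>2) sums (x * exp x)"
proof -
  show m0: "(\<lambda>k. x ^ k / fact k) sums exp x"
    using exp_converges[of x] by (simp add: field_simps)
  have "x ^ Suc k / fact (Suc k) * real (Suc k) = x * (x ^ k / fact k)" for k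
    by (simp add: field_simps del: of_nat_Suc)
  then have "(\<lambda>k. x ^ Suc k / fact (Suc k) * real (Suc k)) sums (x * exp x)"
    using sums_mult[OF m0, of x] by presburger
  then have m1: "(\<lambda>k. x ^ k / fact k * real k) sums (x * exp x)"
    using sums_Suc[of "\<lambda>k. x ^ k / fact k * real k" "x * exp x"] by simp
  have "x ^ Suc k / fact (Suc k) * (real (Suc k))\<^sup>2 = x * (x ^ k / fact k * real k + x ^ k / fact k)" for k
    by (simp add: divide_simps power2_eq_square) (simp add: algebra_simps)
  then have "(\<lambda>k. x ^ Suc k / fact (Suc k) * (real (Suc k))\<^sup>2) sums (x * (x * exp x + exp x))"
    using sums_mult[OF sums_add[OF m1 m0], of x] by presburger
  then have m2: "(\<lambda>k. x ^ k / fact k * (real k)\<^sup>2) sums (x * (x * exp x + exp x))"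
    using sums_Suc[of "\<lambda>k. x ^ k / fact k * (real k)\<^sup>2" "x * (x * exp x + exp x)"] by simp
  show "(\<lambda>k. x ^ k / fact k * (real k - x)) sums 0"
    using sums_diff[OF m1 sums_mult[OF m0, of x]] by (simp add: algebra_simps diff_divide_distrib)
  show "(\<lambda>k. x ^ k / fact k * (real k - x)\<^sup>2) sums (x * exp x)"
    using sums_add[OF sums_diff[OF m2 sums_mult[OF m1, of "2 * x"]] sums_mult[OF m0, of "x\<^sup>2"]]
    by (simp add: power2_eq_square algebra_simps)
qed

text \<open>Over a box the weight is a product, so each term of the expanded square factors over
  coordinates. Off the diagonal a centred first moment appears and kills the term in the limit.
  Truncating at \<open>K\<close> avoids infinite sums over vectors.\<close>

lemma poisson_variance_limit:
  fixes l b :: "nat \<Rightarrow> real"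
  assumes I: "finite I"
  shows "(\<lambda>K. \<Sum>s\<in>PiE I (\<lambda>_. {..K}). (\<Prod>i\<in>I. l i ^ s i / fact (s i)) *
            (\<Sum>i\<in>I. b i * (real (s i) - l i))\<^sup>2)
         \<longlonglongrightarrow> exp (\<Sum>i\<in>I. l i) * (\<Sum>i\<in>I. (b i)\<^sup>2 * l i)"
proof -
  \<comment> \<open>This is the factor at coordinate \<open>m\<close> in the \<open>(i, j)\<close>
    term of the square; when \<open>i = j = m\<close> both conditionals fire and give the squared
    deviation. \<open>L\<close> is its limit after summing over \<open>k\<close>.\<close>
  define c where "c i j m k = l m ^ k / fact k *
      ((if m = i then real k - l m else 1) * (if m = j then real k - l m else 1))" for i j m k
  define L where "L i j m = (if m = i \<and> m = j then l m * exp (l m)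
      else if m = i \<or> m = j then 0 else exp (l m))" for i j m
  have expand: "(\<Sum>s\<in>PiE I (\<lambda>_. {..K}). (\<Prod>i\<in>I. l i ^ s i / fact (s i)) *
            (\<Sum>i\<in>I. b i * (real (s i) - l i))\<^sup>2) =
        (\<Sum>i\<in>I. \<Sum>j\<in>I. b i * b j * (\<Prod>m\<in>I. \<Sum>k\<le>K. c i j m k))" for K
  proof -
    have prodc: "(\<Prod>m\<in>I. c i j m (s m)) =
        (\<Prod>i\<in>I. l i ^ s i / fact (s i)) * ((real (s i) - l i) * (real (s j) - l j))"
      if "i \<in> I" "j \<in> I" for i j s
      using that I by (simp add: c_def prod.distrib prod_dividef)
    have "(\<Sum>s\<in>PiE I (\<lambda>_. {..K}). (\<Prod>i\<in>I. l i ^ s i / fact (s i)) *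
            (\<Sum>i\<in>I. b i * (real (s i) - l i))\<^sup>2) =
        (\<Sum>s\<in>PiE I (\<lambda>_. {..K}). \<Sum>i\<in>I. \<Sum>j\<in>I. b i * b j * (\<Prod>m\<in>I. c i j m (s m)))"
      by (intro sum.cong refl)
        (simp add: power2_eq_square sum_product sum_distrib_left prodc mult_ac)
    also have "\<dots> = (\<Sum>i\<in>I. \<Sum>j\<in>I. b i * b j * (\<Sum>s\<in>PiE I (\<lambda>_. {..K}). \<Prod>m\<in>I. c i j m (s m)))"
      unfolding sum_distrib_left
      by (subst sum.swap, intro sum.cong refl, rule sum.swap)
    also have "\<dots> = (\<Sum>i\<in>I. \<Sum>j\<in>I. b i * b j * (\<Prod>m\<in>I. \<Sum>k\<le>K. c i j m k))"
      using I by (simp add: prod_sum_PiE)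
    finally show ?thesis .
  qed
  have "(\<lambda>K. \<Sum>k\<le>K. c i j m k) \<longlonglongrightarrow> L i j m" for i j m
    using poisson_moments[of "l m"]
    by (auto simp: c_def L_def sums_def_le power2_eq_square)
  then have lim: "(\<lambda>K. \<Sum>i\<in>I. \<Sum>j\<in>I. b i * b j * (\<Prod>m\<in>I. \<Sum>k\<le>K. c i j m k))
      \<longlonglongrightarrow> (\<Sum>i\<in>I. \<Sum>j\<in>I. b i * b j * (\<Prod>m\<in>I. L i j m))"
    by (intro tendsto_intros)
  have prodL: "(\<Prod>m\<in>I. L i j m) = (if i = j then l i * exp (\<Sum>i\<in>I. l i) else 0)"
    if "i \<in> I" "j \<in> I" for i j
  proof (cases "i = j")
    case True
    have "(\<Prod>m\<in>I. L i j m) = (\<Prod>m\<in>I. (if m = i then l m else 1) * exp (l m))"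
      using True by (intro prod.cong) (auto simp: L_def)
    then show ?thesis using I that True by (simp add: prod.distrib exp_sum)
  next
    case False
    have "L i j i = 0" using False by (simp add: L_def)
    then show ?thesis using False I that by (auto intro: prod_zero)
  qed
  have "(\<Sum>i\<in>I. \<Sum>j\<in>I. b i * b j * (\<Prod>m\<in>I. L i j m)) =
      (\<Sum>i\<in>I. \<Sum>j\<in>I. if i = j then (b i)\<^sup>2 * (l i * exp (\<Sum>i\<in>I. l i)) else 0)"
    by (intro sum.cong refl) (simp add: prodL power2_eq_square)
  also have "\<dots> = exp (\<Sum>i\<in>I. l i) * (\<Sum>i\<in>I. (b i)\<^sup>2 * l i)"
    using I by (simp add: sum_distrib_left mult_ac)
  finally show ?thesis using lim by (simp add: expand)
qed

text \<open>The events T = m for \<open>m < n\<close> are disjoint and the integrand is nonnegative,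
  so together they contribute at most the full second moment.\<close>

lemma sum_gsum_le_poisson_variance:
  fixes l b :: "nat \<Rightarrow> real"
  assumes l: "\<And>i. l i \<ge> 0"
  shows "(\<Sum>m<n. gsum l m (\<lambda>s. (\<Sum>i=1..n. b i * (real (s i) - l i))\<^sup>2))
      \<le> exp (\<Sum>i=1..n. l i) * (\<Sum>i=1..n. (b i)\<^sup>2 * l i)"
proof (rule LIMSEQ_le_const[OF poisson_variance_limit[of "{1..n}" l b]])
  define f where "f s = (\<Prod>i=1..n. l i ^ s i / fact (s i)) * (\<Sum>i=1..n. b i * (real (s i) - l i))\<^sup>2"
    for s :: "nat \<Rightarrow> nat"
  let ?U = "\<Union>m\<in>{..<n}. svecs m"
  have f0: "f s \<ge> 0" for s unfolding f_def using l by (intro mult_nonneg_nonneg prod_nonneg) auto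
  \<comment> \<open>Members of \<open>svecs m\<close> vanish outside the index range whereas members
    of \<open>PiE\<close> are \<open>undefined\<close> there; restriction translates between the two
    without changing \<open>f\<close>.\<close>
  have f_restrict: "f (restrict s {1..n}) = f s" for s by (simp add: f_def)
  have zero: "s i = 0" if "s \<in> ?U" "i \<notin> {1..n}" for s i
    using that by (auto simp: svecs_def)
  have inj: "inj_on (\<lambda>s. restrict s {1..n}) ?U"
  proof (rule inj_onI)
    fix s t assume st: "s \<in> ?U" "t \<in> ?U" "restrict s {1..n} = restrict t {1..n}"
    show "s = t"
    proof
      fix i
      show "s i = t i"
        using zero[OF st(1), of i] zero[OF st(2), of i] fun_cong[OF st(3), of i]
        by (cases "i \<in> {1..n}") auto
    qed
  qed
  have "(\<Sum>m<n. gsum l m (\<lambda>s. (\<Sum>i=1..n. b i * (real (s i) - l i))\<^sup>2)) = (\<Sum>m<n. \<Sum>s\<in>svecs m. f s)"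
    unfolding gsum_def f_def
    by (intro sum.cong refl arg_cong2[where f = "(*)"] svecs_prod_extend[symmetric]) auto
  also have "\<dots> = (\<Sum>s\<in>?U. f s)"
  proof (rule sum.UNION_disjoint[symmetric])
    show "\<forall>i\<in>{..<n}. \<forall>j\<in>{..<n}. i \<noteq> j \<longrightarrow> svecs i \<inter> svecs j = {}"
    proof (intro ballI impI equals0I)
      fix i j s assume "i \<in> {..<n}" "j \<in> {..<n}" "i \<noteq> j" "s \<in> svecs i \<inter> svecs j"
      then show False using svecs_sum_extend[of s i n] svecs_sum_extend[of s j n] by simp
    qed
  qed (auto simp: finite_svecs)
  also have "\<dots> = (\<Sum>s\<in>(\<lambda>s. restrict s {1..n}) ` ?U. f s)"
    by (subst sum.reindex[OF inj]) (simp only: o_def f_restrict)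
  finally have eq: "(\<Sum>m<n. gsum l m (\<lambda>s. (\<Sum>i=1..n. b i * (real (s i) - l i))\<^sup>2)) =
      (\<Sum>s\<in>(\<lambda>s. restrict s {1..n}) ` ?U. f s)" .
  show "\<exists>N. \<forall>K\<ge>N. (\<Sum>m<n. gsum l m (\<lambda>s. (\<Sum>i=1..n. b i * (real (s i) - l i))\<^sup>2))
      \<le> (\<Sum>s\<in>PiE {1..n} (\<lambda>_. {..K}). (\<Prod>i=1..n. l i ^ s i / fact (s i)) *
            (\<Sum>i=1..n. b i * (real (s i) - l i))\<^sup>2)"
  \<comment> \<open>Entries of a vector are at most its total, which is below \<open>n\<close>;
    every box with \<open>K \<ge> n\<close> therefore contains all of them.\<close>
  proof (intro exI[of _ n] allI impI)
    fix K assume K: "n \<le> K"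
    have "s i \<le> K" if "s \<in> svecs m" "m < n" for s m i
      using svecs_le[OF that(1), of i] that(2) K by linarith
    then have sub: "(\<lambda>s. restrict s {1..n}) ` ?U \<subseteq> PiE {1..n} (\<lambda>_. {..K})"
      by auto
    show "(\<Sum>m<n. gsum l m (\<lambda>s. (\<Sum>i=1..n. b i * (real (s i) - l i))\<^sup>2))
      \<le> (\<Sum>s\<in>PiE {1..n} (\<lambda>_. {..K}). (\<Prod>i=1..n. l i ^ s i / fact (s i)) *
            (\<Sum>i=1..n. b i * (real (s i) - l i))\<^sup>2)"
      unfolding eq f_def[symmetric] using f0 sub
      by (intro sum_mono2 finite_PiE) auto
  qed
qed simp

section \<open>Second moments of additive functions\<close>

lemma sum_square_le: "(x + y)\<^sup>2 \<le> 2 * x\<^sup>2 + 2 * (y :: real)\<^sup>2"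
  using sum_squares_bound[of x y] by (simp add: power2_sum)

text \<open>For \<open>2 * j \<le> n\<close> the lower bound \<open>low\<close> is used at \<open>n - j\<close> rather than \<open>n\<close>, so that the factor
  \<open>gsum m (n - j)\<close> appears; the change of the exponential costs only \<open>exp T\<close>.\<close>

lemma small_parts_bound:
  fixes m a :: "nat \<Rightarrow> real"
  assumes m0: "\<And>i. m i \<ge> 0"
    and mT: "\<And>i. i \<ge> 1 \<Longrightarrow> real i * m i \<le> T"
    and t: "t > 0"
    and low: "\<And>k. k \<ge> 1 \<Longrightarrow> t * exp (\<Sum>j=1..k. m j) \<le> real k * gsum m k (\<lambda>_. 1)"
    and n: "n \<ge> 1"
    and a0: "\<And>i. n < 2 * i \<Longrightarrow> a i = 0"
  shows "gsum m n (\<lambda>s. (\<Sum>i=1..n. a i * (real (s i) - m i))\<^sup>2)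
     \<le> (2 * T * exp T / t + 1) * (\<Sum>j=1..n. (a j)\<^sup>2 * m j * gsum m (n - j) (\<lambda>_. 1))"
proof -
  define q where "q k = gsum m k (\<lambda>_. 1)" for k
  define h where "h s = (\<Sum>i=1..n. a i * (real (s i) - m i))" for s :: "nat \<Rightarrow> nat"
  define M where "M k = gsum m k (\<lambda>s. (h s)\<^sup>2)" for k
  define R where "R = (\<Sum>j=1..n. (a j)\<^sup>2 * m j * q (n - j))"
  have T0: "T \<ge> 0" using mT[of 1] m0[of 1] by simp
  have q0: "q k \<ge> 0" for k unfolding q_def by (intro gsum_nonneg m0) auto
  have M0: "M k \<ge> 0" for k unfolding M_def by (intro gsum_nonneg m0) auto
  have h_step: "h (s(j := Suc (s j))) = h s + a j" if "j \<in> {1..n}" for s j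
  proof -
    have "h (s(j := Suc (s j))) = (\<Sum>i=1..n. a i * (real (s i) - m i) + (if i = j then a j else 0))"
      unfolding h_def by (intro sum.cong) (auto simp: algebra_simps)
    then show ?thesis using that by (simp add: h_def sum.distrib)
  qed
  have exp_le: "(a j)\<^sup>2 * m j * exp (\<Sum>i=1..n. m i) \<le> (a j)\<^sup>2 * m j * (exp T / t * real n * q (n - j))"
    if j: "j \<in> {1..n}" for j
  proof (cases "a j = 0")
    case False
    then have j2: "2 * j \<le> n" using a0[of j] by (meson not_le)
    then have nj: "n - j \<ge> 1" using j by auto
    have "(\<Sum>i=1..n. m i) = (\<Sum>i=1..n-j. m i) + (\<Sum>i\<in>{n-j+1..n}. m i)"
      using sum.ub_add_nat[of 1 "n - j" m j] j by simp
    \<comment> \<open>The tail has \<open>j\<close> terms, each at most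
      \<open>T / (n - j + 1)\<close>. Since \<open>2 * j \<le> n\<close> gives
      \<open>j \<le> n - j\<close>, the tail is at most \<open>T\<close>.\<close>
    also have "(\<Sum>i\<in>{n-j+1..n}. m i) \<le> (\<Sum>i\<in>{n-j+1..n}. T / real (n - j + 1))"
    proof (rule sum_mono)
      fix i assume i: "i \<in> {n-j+1..n}"
      have "real (n - j + 1) * m i \<le> real i * m i" using i m0 by (intro mult_right_mono) auto
      also have "\<dots> \<le> T" using i by (intro mT) auto
      finally show "m i \<le> T / real (n - j + 1)"
        by (subst pos_le_divide_eq) (simp_all add: mult.commute)
    qed
    also have "\<dots> = real j * T / real (n - j + 1)" using j by simp
    also have "\<dots> \<le> T"
    proof -
      have "real j * T \<le> real (n - j + 1) * T" using j2 T0 by (intro mult_right_mono) auto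
      then show ?thesis by (subst pos_divide_le_eq) (simp_all add: mult.commute)
    qed
    finally have "exp (\<Sum>i=1..n. m i) \<le> exp T * exp (\<Sum>i=1..n-j. m i)"
      by (simp flip: exp_add)
    also have "\<dots> \<le> exp T * (real (n - j) * q (n - j) / t)"
      using low[OF nj] t by (intro mult_left_mono) (simp_all add: q_def field_simps)
    also have "\<dots> \<le> exp T * (real n * q (n - j) / t)"
      using q0 t by (intro mult_left_mono divide_right_mono mult_right_mono) auto
    finally show ?thesis
      using m0 by (intro mult_left_mono) (simp_all add: field_simps)
  qed auto
  have "real n * M n = (\<Sum>j=1..n. real j * m j * gsum m (n - j) (\<lambda>s. (h s + a j)\<^sup>2))"
    unfolding M_def gsum_rec by (simp add: h_step)
  also have "\<dots> \<le> (\<Sum>j=1..n. real j * m j * (2 * M (n - j) + 2 * (a j)\<^sup>2 * q (n - j)))"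
  proof (intro sum_mono mult_left_mono)
    fix j
    have "gsum m (n - j) (\<lambda>s. (h s + a j)\<^sup>2) \<le> gsum m (n - j) (\<lambda>s. 2 * (h s)\<^sup>2 + 2 * (a j)\<^sup>2 * 1)"
      using m0 sum_square_le by (intro gsum_mono) auto
    then show "gsum m (n - j) (\<lambda>s. (h s + a j)\<^sup>2) \<le> 2 * M (n - j) + 2 * (a j)\<^sup>2 * q (n - j)"
      by (simp only: gsum_add gsum_cmult M_def q_def)
  qed (use m0 in auto)
  also have "\<dots> \<le> (\<Sum>j=1..n. T * (2 * M (n - j)) + real n * ((a j)\<^sup>2 * m j * q (n - j)))"
  proof (rule sum_mono)
    fix j assume j: "j \<in> {1..n}"
    have "real j * m j * (2 * M (n - j)) \<le> T * (2 * M (n - j))"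
      using mT[of j] M0 j by (intro mult_right_mono) auto
    \<comment> \<open>In the diagonal term \<open>2 * j\<close> is absorbed by \<open>n\<close>,
      because \<open>a j\<close> vanishes unless \<open>2 * j \<le> n\<close>. This produces the
      summand 1 in the constant.\<close>
    moreover have "real j * m j * (2 * (a j)\<^sup>2 * q (n - j)) \<le> real n * ((a j)\<^sup>2 * m j * q (n - j))"
    proof (cases "a j = 0")
      case False
      then have "2 * j \<le> n" using a0[of j] by (meson not_le)
      then have "(2 * real j) * ((a j)\<^sup>2 * m j * q (n - j)) \<le> real n * ((a j)\<^sup>2 * m j * q (n - j))"
        using m0 q0 by (intro mult_right_mono mult_nonneg_nonneg) auto
      then show ?thesis by (simp add: mult_ac)
    qed simp
    ultimately show "real j * m j * (2 * M (n - j) + 2 * (a j)\<^sup>2 * q (n - j))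
        \<le> T * (2 * M (n - j)) + real n * ((a j)\<^sup>2 * m j * q (n - j))"
      by (simp only: distrib_left)
  qed
  also have "\<dots> = 2 * T * (\<Sum>j=1..n. M (n - j)) + real n * R"
    by (simp add: sum.distrib sum_distrib_left R_def mult_ac)
  \<comment> \<open>The remaining totals \<open>n - j\<close> run once through all values below
    \<open>n\<close>, so the unconditional variance bounds their joint contribution.\<close>
  also have "(\<Sum>j=1..n. M (n - j)) = (\<Sum>k<n. M k)"
    by (rule sum.reindex_bij_witness[where i = "\<lambda>k. n - k" and j = "\<lambda>j. n - j"]) auto
  also have "(\<Sum>k<n. M k) \<le> exp (\<Sum>i=1..n. m i) * (\<Sum>i=1..n. (a i)\<^sup>2 * m i)"
    unfolding M_def h_def by (rule sum_gsum_le_poisson_variance[OF m0])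
  also have "\<dots> = (\<Sum>j=1..n. (a j)\<^sup>2 * m j * exp (\<Sum>i=1..n. m i))"
    by (simp add: sum_distrib_left mult_ac)
  also have "\<dots> \<le> (\<Sum>j=1..n. (a j)\<^sup>2 * m j * (exp T / t * real n * q (n - j)))"
    by (intro sum_mono exp_le)
  also have "\<dots> = exp T / t * real n * R"
    by (simp add: R_def sum_distrib_left mult_ac)
  finally have "real n * M n \<le> 2 * T * (exp T / t * real n * R) + real n * R"
    using T0 by (simp add: mult_left_mono)
  also have "\<dots> = real n * ((2 * T * exp T / t + 1) * R)" by (simp add: algebra_simps)
  finally have "M n \<le> (2 * T * exp T / t + 1) * R" using n by simp
  then show ?thesis by (simp add: M_def h_def R_def q_def)
qed

text \<open>Two parts larger than \<open>n / 2\<close> do not fit into \<open>n\<close>. Hence at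
  most one summand is nonzero, its count is 1, and squaring acts termwise.\<close>

lemma large_parts_square:
  assumes s: "s \<in> svecs n"
    and a0: "\<And>i. 2 * i \<le> n \<Longrightarrow> a i = 0"
  shows "(\<Sum>j=1..n. a j * real (s j))\<^sup>2 = (\<Sum>j=1..n. (a j)\<^sup>2 * real (s j))"
proof (cases "\<exists>j\<in>{1..n}. n < 2 * j \<and> s j \<noteq> 0")
  case True
  then obtain j where j: "j \<in> {1..n}" "n < 2 * j" "s j \<noteq> 0" by auto
  have tot: "j * s j + (\<Sum>i\<in>{1..n}-{j}. i * s i) = n"
    using s sum.remove[of "{1..n}" j "\<lambda>i. i * s i"] j by (simp add: svecs_def)
  have "s j < 2"
  proof (rule ccontr)
    assume "\<not> s j < 2"
    then have "j * 2 \<le> j * s j" by (intro mult_left_mono) auto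
    then show False using tot j by linarith
  qed
  then have sj: "s j = 1" using j by linarith
  have other: "a i * real (s i) = 0" if "i \<in> {1..n}-{j}" for i
  proof (rule ccontr)
    assume "a i * real (s i) \<noteq> 0"
    then have "a i \<noteq> 0" "s i \<noteq> 0" by auto
    then have "n < 2 * i" using a0[of i] not_le by blast
    moreover have "i * s i \<le> (\<Sum>i\<in>{1..n}-{j}. i * s i)"
      using that by (intro member_le_sum) auto
    moreover have "i \<le> i * s i" using \<open>s i \<noteq> 0\<close> by simp
    moreover have "j + (\<Sum>i\<in>{1..n}-{j}. i * s i) = n" using tot sj by simp
    ultimately show False using j by linarith
  qed
  have other': "(a i)\<^sup>2 * real (s i) = 0" if "i \<in> {1..n}-{j}" for i
    using other[OF that] by auto
  have "(\<Sum>i=1..n. a i * real (s i)) = a j"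
    using sum.remove[of "{1..n}" j "\<lambda>i. a i * real (s i)"] j sj other by simp
  moreover have "(\<Sum>i=1..n. (a i)\<^sup>2 * real (s i)) = (a j)\<^sup>2"
    using sum.remove[of "{1..n}" j "\<lambda>i. (a i)\<^sup>2 * real (s i)"] j sj other'
    by simp
  ultimately show ?thesis by simp
next
  case False
  then have "a j * real (s j) = 0" if "j \<in> {1..n}" for j
    using that a0[of j] by (cases "2 * j \<le> n") auto
  then show ?thesis by (simp add: sum.neutral)
qed

text \<open>Once the square is linear in the counts, marking evaluates it exactly.\<close>

lemma gsum_large_parts:
  assumes a0: "\<And>i. 2 * i \<le> n \<Longrightarrow> a i = 0"
  shows "gsum l n (\<lambda>s. (\<Sum>j=1..n. a j * real (s j))\<^sup>2) =
    (\<Sum>j=1..n. (a j)\<^sup>2 * l j * gsum l (n - j) (\<lambda>_. 1))"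
proof -
  have "gsum l n (\<lambda>s. (\<Sum>j=1..n. a j * real (s j))\<^sup>2) =
      gsum l n (\<lambda>s. \<Sum>j=1..n. (a j)\<^sup>2 * (real (s j) * 1))"
    by (rule gsum_cong) (use large_parts_square[OF _ a0] in simp)
  also have "\<dots> = (\<Sum>j=1..n. (a j)\<^sup>2 * gsum l n (\<lambda>s. real (s j) * 1))"
    by (simp only: gsum_sum gsum_cmult)
  also have "\<dots> = (\<Sum>j=1..n. (a j)\<^sup>2 * l j * gsum l (n - j) (\<lambda>_. 1))"
    by (intro sum.cong refl) (subst gsum_mark, auto)
  finally show ?thesis .
qed

text \<open>Any centring suffices, since the variance minimises over it. The witness is the Poisson
  mean \<open>a i * m i\<close> for small parts and 0 for large ones.\<close>

lemma gsum_additive_second_moment: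
  fixes m a :: "nat \<Rightarrow> real"
  assumes m0: "\<And>i. m i \<ge> 0"
    and mT: "\<And>i. i \<ge> 1 \<Longrightarrow> real i * m i \<le> T"
    and t: "t > 0"
    and low: "\<And>k. k \<ge> 1 \<Longrightarrow> t * exp (\<Sum>j=1..k. m j) \<le> real k * gsum m k (\<lambda>_. 1)"
    and n: "n \<ge> 1"
  shows "\<exists>A. gsum m n (\<lambda>s. (\<Sum>i=1..n. a i * real (s i) - A i)\<^sup>2)
     \<le> (4 * T * exp T / t + 2) * (\<Sum>j=1..n. (a j)\<^sup>2 * m j * gsum m (n - j) (\<lambda>_. 1))"
proof -
  define b where "b i = (if 2 * i \<le> n then a i else 0)" for i
  define c where "c i = (if 2 * i \<le> n then 0 else a i)" for i
  define K where "K = 2 * T * exp T / t + 1"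
  define D where "D x = (\<Sum>j=1..n. (x j)\<^sup>2 * m j * gsum m (n - j) (\<lambda>_. 1))" for x :: "nat \<Rightarrow> real"
  have T0: "T \<ge> 0" using mT[of 1] m0[of 1] by simp
  have K1: "K \<ge> 1" using T0 t by (simp add: K_def)
  have D0: "D x \<ge> 0" for x
    unfolding D_def using m0 by (intro sum_nonneg mult_nonneg_nonneg gsum_nonneg) auto
  have split: "(\<Sum>i=1..n. a i * real (s i) - b i * m i) =
      (\<Sum>i=1..n. b i * (real (s i) - m i)) + (\<Sum>i=1..n. c i * real (s i))" for s :: "nat \<Rightarrow> nat"
    unfolding sum.distrib[symmetric] by (intro sum.cong) (auto simp: b_def c_def algebra_simps)
  have "gsum m n (\<lambda>s. (\<Sum>i=1..n. a i * real (s i) - b i * m i)\<^sup>2) \<le>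
      gsum m n (\<lambda>s. 2 * (\<Sum>i=1..n. b i * (real (s i) - m i))\<^sup>2 + 2 * (\<Sum>i=1..n. c i * real (s i))\<^sup>2)"
    unfolding split by (intro gsum_mono m0 sum_square_le)
  also have "\<dots> = 2 * gsum m n (\<lambda>s. (\<Sum>i=1..n. b i * (real (s i) - m i))\<^sup>2) +
      2 * gsum m n (\<lambda>s. (\<Sum>i=1..n. c i * real (s i))\<^sup>2)"
    by (simp only: gsum_add gsum_cmult)
  also have "\<dots> \<le> 2 * (K * D b) + 2 * D c"
  proof -
    have "gsum m n (\<lambda>s. (\<Sum>i=1..n. b i * (real (s i) - m i))\<^sup>2) \<le> K * D b"
      unfolding K_def D_def by (rule small_parts_bound) (use assms in \<open>auto simp: b_def\<close>)
    moreover have "gsum m n (\<lambda>s. (\<Sum>i=1..n. c i * real (s i))\<^sup>2) = D c"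
      unfolding D_def by (rule gsum_large_parts) (simp add: c_def)
    ultimately show ?thesis by simp
  qed
  also have "\<dots> \<le> 2 * K * (D b + D c)"
    using K1 D0[of c] mult_right_mono[OF K1 D0[of c]] by (simp add: algebra_simps)
  \<comment> \<open>For each index one of \<open>b\<close> and \<open>c\<close> is zero, so the
    squares add without cross terms.\<close>
  also have "D b + D c = D a"
    unfolding D_def sum.distrib[symmetric] by (intro sum.cong) (auto simp: b_def c_def)
  also have "2 * K = 4 * T * exp T / t + 2" by (simp add: K_def)
  finally show ?thesis unfolding D_def by (rule exI[of _ "\<lambda>i. b i * m i"])
qed

section \<open>Passage to the variance over assemblies\<close>

text \<open>Expanding around the mean, the cross term vanishes and a nonnegative multiple of
  \<open>(e - A)\<^sup>2\<close> remains.\<close>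

lemma Vn_le:
  assumes "real (card (assemblies g n)) > 0"
  shows "Vn g n h \<le> (\<Sum>\<sigma>\<in>assemblies g n. (h \<sigma> - A)\<^sup>2) / real (card (assemblies g n))"
proof -
  let ?S = "assemblies g n"
  define e where "e = En g n h"
  have e: "(\<Sum>\<sigma>\<in>?S. h \<sigma> - e) = 0"
    using assms by (simp add: e_def En_def sum_subtractf)
  have "(\<Sum>\<sigma>\<in>?S. (h \<sigma> - A)\<^sup>2) = (\<Sum>\<sigma>\<in>?S. (h \<sigma> - e)\<^sup>2 + (e - A)\<^sup>2 + 2 * (e - A) * (h \<sigma> - e))"
    by (intro sum.cong refl) (simp add: power2_eq_square algebra_simps)
  also have "\<dots> = (\<Sum>\<sigma>\<in>?S. (h \<sigma> - e)\<^sup>2) + real (card ?S) * (e - A)\<^sup>2 + 2 * (e - A) * (\<Sum>\<sigma>\<in>?S. h \<sigma> - e)"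
    by (simp add: sum.distrib sum_distrib_left)
  finally have "(\<Sum>\<sigma>\<in>?S. (h \<sigma> - e)\<^sup>2) \<le> (\<Sum>\<sigma>\<in>?S. (h \<sigma> - A)\<^sup>2)" by (simp add: e)
  then show ?thesis by (simp add: Vn_def e_def divide_right_mono)
qed

theorem theorem2:
  fixes \<rho> \<Theta> \<theta> \<theta>' :: real and n0 :: nat
  assumes "\<rho> > 0" "\<Theta> > 0" "\<theta> > 0" "\<theta>' > 0" "n0 \<ge> 1"
  shows "\<exists>C>0. \<forall>g. weakly_logarithmic g \<rho> \<Theta> \<theta> \<theta>' n0 \<longrightarrow>
           (\<forall>n\<ge>1. \<forall>a :: nat \<Rightarrow> real.
              Vn g n (\<lambda>\<sigma>. \<Sum>j=1..n. a j * real (kcomp j \<sigma>))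
                \<le> C * (\<Sum>j=1..n. lam g j * (a j)^2 * (Qfun g (n - j) / Qfun g n)))"
\<comment> \<open>The constant is that of \<open>gsum_additive_second_moment\<close> with
  \<open>T = \<Theta>\<close> and \<open>t = \<theta>'\<close>.\<close>
proof (intro exI[of _ "4 * \<Theta> * exp \<Theta> / \<theta>' + 2"] conjI allI impI)
  let ?C = "4 * \<Theta> * exp \<Theta> / \<theta>' + 2"
  have "4 * \<Theta> * exp \<Theta> / \<theta>' > 0" using assms by simp
  then show "?C > 0" by linarith
  fix g n and a :: "nat \<Rightarrow> real"
  assume wl: "weakly_logarithmic g \<rho> \<Theta> \<theta> \<theta>' n0" and n: "(1 :: nat) \<le> n"
  define m where "m j = lam g j * \<rho> ^ j" for j
  have gs: "gsum m k F = \<rho> ^ k * gsum (lam g) k F" for k F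
    unfolding m_def by (rule gsum_tilt)
  have m0: "m i \<ge> 0" for i using assms by (simp add: m_def lam_def)
  have mT: "real i * m i \<le> \<Theta>" if "i \<ge> 1" for i
    using wl that by (simp add: weakly_logarithmic_def m_def mult_ac)
  have low: "\<theta>' * exp (\<Sum>j=1..k. m j) \<le> real k * gsum m k (\<lambda>_. 1)" if "k \<ge> 1" for k
    using wl that by (simp add: weakly_logarithmic_def m_def[symmetric] gs Qfun_eq_gsum mult_ac)
  \<comment> \<open>The lower bound in the definition of the class forces
    \<open>Qfun g n > 0\<close>, so assemblies exist and the divisions are genuine.\<close>
  have "0 < \<theta>' * exp (\<Sum>j=1..n. m j)" using assms by simp
  also have "\<dots> \<le> real n * \<rho> ^ n * Qfun g n" using low[OF n] by (simp add: gs Qfun_eq_gsum)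
  finally have Q: "Qfun g n > 0"
    by (rule zero_less_mult_pos) (use assms n in simp)
  have card: "real (card (assemblies g n)) > 0" using Q by (simp add: card_assemblies)
  obtain A where A: "gsum m n (\<lambda>s. (\<Sum>i=1..n. a i * real (s i) - A i)\<^sup>2)
     \<le> ?C * (\<Sum>j=1..n. (a j)\<^sup>2 * m j * gsum m (n - j) (\<lambda>_. 1))"
    using gsum_additive_second_moment[OF m0 mT assms(4) low n, of a] by auto
  \<comment> \<open>Undoing the tilt: \<open>m j\<close> contributes \<open>\<rho> ^ j\<close> and
    the inner sum \<open>\<rho> ^ (n - j)\<close>, so a common factor \<open>\<rho> ^ n\<close>
    cancels from the inequality.\<close>
  have "(\<Sum>j=1..n. (a j)\<^sup>2 * m j * gsum m (n - j) (\<lambda>_. 1)) =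
      \<rho> ^ n * (\<Sum>j=1..n. lam g j * (a j)\<^sup>2 * Qfun g (n - j))"
    unfolding sum_distrib_left
  proof (intro sum.cong refl)
    fix j assume "j \<in> {1..n}"
    then have "\<rho> ^ n = \<rho> ^ j * \<rho> ^ (n - j)" by (simp flip: power_add)
    then show "(a j)\<^sup>2 * m j * gsum m (n - j) (\<lambda>_. 1) = \<rho> ^ n * (lam g j * (a j)\<^sup>2 * Qfun g (n - j))"
      by (simp add: gs m_def Qfun_eq_gsum)
  qed
  then have "\<rho> ^ n * gsum (lam g) n (\<lambda>s. (\<Sum>i=1..n. a i * real (s i) - A i)\<^sup>2)
      \<le> \<rho> ^ n * (?C * (\<Sum>j=1..n. lam g j * (a j)\<^sup>2 * Qfun g (n - j)))"
    using A by (simp add: gs mult_ac)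
  then have main: "gsum (lam g) n (\<lambda>s. (\<Sum>i=1..n. a i * real (s i) - A i)\<^sup>2)
      \<le> ?C * (\<Sum>j=1..n. lam g j * (a j)\<^sup>2 * Qfun g (n - j))"
    using assms by simp
  have "Vn g n (\<lambda>\<sigma>. \<Sum>j=1..n. a j * real (kcomp j \<sigma>)) \<le>
      (\<Sum>\<sigma>\<in>assemblies g n. ((\<Sum>j=1..n. a j * real (kcomp j \<sigma>)) - (\<Sum>j=1..n. A j))\<^sup>2) /
        real (card (assemblies g n))"
    by (rule Vn_le[OF card])
  \<comment> \<open>The factor \<open>fact n\<close> occurs in both the sum and the number of
    assemblies and cancels.\<close>
  also have "\<dots> = gsum (lam g) n (\<lambda>s. (\<Sum>i=1..n. a i * real (s i) - A i)\<^sup>2) / Qfun g n"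
    using sum_assemblies_eq_gsum[where F = "\<lambda>s. (\<Sum>i=1..n. a i * real (s i) - A i)\<^sup>2"]
    by (simp add: card_assemblies sum_subtractf)
  also have "\<dots> \<le> ?C * (\<Sum>j=1..n. lam g j * (a j)\<^sup>2 * Qfun g (n - j)) / Qfun g n"
    using main Q by (intro divide_right_mono) auto
  also have "\<dots> = ?C * (\<Sum>j=1..n. lam g j * (a j)\<^sup>2 * (Qfun g (n - j) / Qfun g n))"
    unfolding times_divide_eq_right[of ?C, symmetric] by (simp add: sum_divide_distrib)
  finally show "Vn g n (\<lambda>\<sigma>. \<Sum>j=1..n. a j * real (kcomp j \<sigma>)) \<le>
      ?C * (\<Sum>j=1..n. lam g j * (a j)\<^sup>2 * (Qfun g (n - j) / Qfun g n))" .
qed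

end
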